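(* Let $R$ be a 2-fir. a) For every $a\in R\setminus\{0\}$, $V(a)$ is an $F$-algebraic set and $rk(V(a))\le\ell(a)$. b) If $\Delta$ is an $F$-algebraic set of atoms with an $F$-basis $B$, then $\overline{\Delta}$ is $F$-algebraic, $\overline{B}=\overline{\Delta}$ and $rk(\Delta)=rk(\overline{\Delta})$. If $\Delta$ is of finite rank, then $\overline{\Delta}=V(\Delta_\ell)=V(B_\ell)=\overline{B}$, where $\Delta_\ell,B_\ell\in R$ are elements such that $\bigcap_{\delta\in\Delta}R\delta=R\Delta_\ell$ and $\bigcap_{b\in B}Rb=RB_\ell$. c) Let $a,b\in\mathcal F$ be such that $Ra\cap Rb\neq0$, and let $[a,b]_\ell\in R$ be such that $Ra\cap Rb=R[a,b]_\ell$. Then the following are equivalent: $V(a)\cap V(b)=\emptyset$; $Ra+Rb=R$; $\ell([a,b]_\ell)=\ell(a)+\ell(b)$. d) If $C$ is a finite $F$-algebraic set of atoms, then $rk(C)\le|C|$, and equality occurs if and only if $C$ is $F$-independent.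
   Context: Rings are associative with $1$, not necessarily commutative. A 2-fir is a domain $R$ such that for all $a,b\in R$ with $aR\cap bR\neq 0$ there are $c,d\in R$ with $aR\cap bR=cR$ and $aR+bR=dR$ (this condition is left-right symmetric). $U(R)$ is the group of units. An atom is a nonzero non-unit that is not a product of two non-units; $\mathcal A$ is the set of atoms. The length $\ell(a)$ of $a$ is the least $n$ such that $a$ is a product of $n$ atoms, $0$ if $a$ is a unit, and $\infty$ if $a$ is neither a unit nor a finite product of atoms; $\mathcal F=\{x\in R: \ell(x)<\infty\}$ (so $0\notin\mathcal F$, $U(R)\subseteq\mathcal F$). The intersection of an empty family of left ideals is $R$. A subset $\Delta\subseteq\mathcal F\setminus U(R)$ is $F$-algebraic if $\bigcap_{\delta\in\Delta}R\delta\neq0$. For $\Delta$ $F$-algebraic, $d\in\mathcal F$ is $F$-dependent on $\Delta$ if $\Delta\cup\{d\}$ is $F$-algebraic and there is a finite subset $\Gamma\subseteq\Delta$ with $Rd+\bigcap_{\gamma\in\Gamma}R\gamma\neq R$. $\Delta$ is $F$-independent if no $\delta\in\Delta$ is $F$-dependent on $\Delta\setminus\{\delta\}$. An $F$-basis of $\Delta$ is an $F$-independent subset $B\subseteq\Delta$ such that every element of $\Delta$ is $F$-dependent on $B$. For an $F$-algebraic set $\Delta$ of atoms, $rk(\Delta)=|B|$ for any $F$-basis $B$ of $\Delta$ (every such $\Delta$ has an $F$-basis, and all $F$-bases have the same cardinality); when $B$ is infinite one says the rank is $\infty$. When $\Delta$ has finite rank, the elements $\Delta_\ell$ and $B_\ell$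 of part b) exist and are unique up to left multiplication by a unit. The closure $\overline{\Delta}$ is the set of atoms that are $F$-dependent on $\Delta$. For $a\in R\setminus\{0\}$, $V(a)=\{p\in\mathcal A: a\in Rp\}$. *)

theory Defs
  imports "HOL-Library.Set_Algebras" "HOL-Library.Extended_Nat"
begin

definition (in times) right_ideal :: "'a \<Rightarrow> 'a set" where
  "right_ideal a = {a * r |r. True}"

definition left_ideal :: "'a::times \<Rightarrow> 'a set" where
  "left_ideal a = {r * a |r. True}"

text \<open>
  The sort \<open>ring_1_no_zero_divisors\<close> is that of (not necessarily commutative) domains.
  Sums of left ideals below are the elementwise sums of sets from \<open>Set_Algebras\<close>; that
  instance is not available inside a class specification, so here the sum is written out.
\<close>

class two_fir = ring_1_no_zero_divisors +
  assumes two_fir: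
    "right_ideal a \<inter> right_ideal b \<noteq> {0} \<Longrightarrow>
      \<exists>c d. right_ideal a \<inter> right_ideal b = right_ideal c \<and>
            {x + y |x y. x \<in> right_ideal a \<and> y \<in> right_ideal b} = right_ideal d"

text \<open>
  The library's \<open>is_unit\<close> and \<open>irreducible\<close> are only available for commutative
  semirings, hence the following noncommutative versions.
\<close>

definition units :: "'a::monoid_mult set" where
  "units = {u. \<exists>v. u * v = 1 \<and> v * u = 1}"

definition atoms :: "'a::ring_1 set" where
  "atoms = {p. p \<noteq> 0 \<and> p \<notin> units \<and> (\<forall>a b. p = a * b \<longrightarrow> a \<in> units \<or> b \<in> units)}"

text \<open>The infimum of the empty set is \<open>\<infinity>\<close> in \<^typ>\<open>enat\<close>.\<close>

definition len :: "'a::ring_1 \<Rightarrow> enat" where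
  "len a = (if a \<in> units then 0
     else Inf {enat (length ps) |ps. set ps \<subseteq> atoms \<and> a = prod_list ps})"

definition finite_len :: "'a::ring_1 set" where
  "finite_len = {a. len a < \<infinity>}"

text \<open>In the following, the intersection of the empty family is \<^term>\<open>UNIV\<close>, i.e. the whole ring.\<close>

definition F_algebraic :: "'a::ring_1 set \<Rightarrow> bool" where
  "F_algebraic \<Delta> \<longleftrightarrow>
     \<Delta> \<subseteq> finite_len - units \<and> (\<Inter>\<delta>\<in>\<Delta>. left_ideal \<delta>) \<noteq> {0}"

definition F_dependent :: "'a::ring_1 \<Rightarrow> 'a set \<Rightarrow> bool" where
  "F_dependent d \<Delta> \<longleftrightarrow>
     F_algebraic \<Delta> \<and> d \<in> finite_len \<and> F_algebraic (\<Delta> \<union> {d}) \<and>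
     (\<exists>\<Gamma>\<subseteq>\<Delta>. finite \<Gamma> \<and> left_ideal d + (\<Inter>\<gamma>\<in>\<Gamma>. left_ideal \<gamma>) \<noteq> UNIV)"

definition F_independent :: "'a::ring_1 set \<Rightarrow> bool" where
  "F_independent \<Delta> \<longleftrightarrow>
     F_algebraic \<Delta> \<and> (\<forall>\<delta>\<in>\<Delta>. \<not> F_dependent \<delta> (\<Delta> - {\<delta>}))"

definition F_basis :: "'a::ring_1 set \<Rightarrow> 'a set \<Rightarrow> bool" where
  "F_basis B \<Delta> \<longleftrightarrow>
     B \<subseteq> \<Delta> \<and> F_independent B \<and> (\<forall>\<delta>\<in>\<Delta>. F_dependent \<delta> B)"

definition ecard :: "'a set \<Rightarrow> enat" where
  "ecard A = (if finite A then enat (card A) else \<infinity>)"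

text \<open>
  The rank is the common cardinality of all \<open>F\<close>-bases. It is meaningful for \<open>F\<close>-algebraic
  sets of atoms in a 2-fir, where \<open>F\<close>-bases exist and are equinumerous.
\<close>

definition rk :: "'a::ring_1 set \<Rightarrow> enat" where
  "rk \<Delta> = (THE r. \<exists>B. F_basis B \<Delta> \<and> r = ecard B)"

definition F_closure :: "'a::ring_1 set \<Rightarrow> 'a set" where
  "F_closure \<Delta> = {p \<in> atoms. F_dependent p \<Delta>}"

definition V :: "'a::ring_1 \<Rightarrow> 'a set" where
  "V a = {p \<in> atoms. a \<in> left_ideal p}"

end

theory Submission
  imports Defs
begin

text \<open>
  The 2-fir condition is left-right symmetric, and if \<open>Ra + Rb = R\<close> and \<open>Ra \<inter> Rb = Rb'a \<noteq> 0\<close>, then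
  factorizations of \<open>b\<close> and of \<open>b'\<close> correspond to each other. This yields unique factorization
  lengths and the formula \<open>\<ell>(a) + \<ell>(b) = \<ell>(gcd) + \<ell>(lcm)\<close>, hence part c).
  An atom \<open>p\<close> is \<open>F\<close>-dependent on \<open>\<Delta>\<close> iff some finite intersection of ideals
  \<open>R\<delta>\<close> lies in \<open>Rp\<close>, and intersecting \<open>Rm\<close> with an \<open>Rp\<close> not containing it raises the length by
  exactly one. So a finite set of atoms is independent iff its cardinality is the length of its
  left least common multiple, which identifies the rank with a length.
\<close>

section \<open>Units and atoms in a domain\<close>

lemma mult_eq_1_swap:
  fixes x y :: "'a::ring_1_no_zero_divisors"
  assumes "x * y = 1"
  shows "y * x = 1"
proof -
  have "x * (y * x) = x * 1" using assms by (simp add: mult.assoc [symmetric])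
  moreover have "x \<noteq> 0" using assms by auto
  ultimately show ?thesis by simp
qed

lemma units_iff_left:
  fixes u :: "'a::ring_1_no_zero_divisors"
  shows "u \<in> units \<longleftrightarrow> (\<exists>v. v * u = 1)"
  unfolding units_def using mult_eq_1_swap by blast

lemma units_iff_right:
  fixes u :: "'a::ring_1_no_zero_divisors"
  shows "u \<in> units \<longleftrightarrow> (\<exists>v. u * v = 1)"
  unfolding units_def using mult_eq_1_swap by blast

lemma units_mult_iff:
  fixes u v :: "'a::ring_1_no_zero_divisors"
  shows "u * v \<in> units \<longleftrightarrow> u \<in> units \<and> v \<in> units"
proof
  assume "u * v \<in> units"
  then show "u \<in> units \<and> v \<in> units"
    by (metis units_iff_left units_iff_right mult.assoc)
next
  assume "u \<in> units \<and> v \<in> units"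
  then obtain u' v' where "u * u' = 1" "v * v' = 1" by (auto simp: units_iff_right)
  then have "u * v * (v' * u') = 1" by (metis mult.assoc mult_1_left)
  then show "u * v \<in> units" by (auto simp: units_iff_right)
qed

lemma one_in_units [simp]: "(1::'a::monoid_mult) \<in> units"
  by (auto simp: units_def)

lemma zero_notin_units [simp]: "(0::'a::ring_1_no_zero_divisors) \<notin> units"
  by (auto simp: units_def)

lemma atoms_nonzero: "p \<in> atoms \<Longrightarrow> p \<noteq> 0"
  by (simp add: atoms_def)

lemma atoms_not_unit: "p \<in> atoms \<Longrightarrow> p \<notin> units"
  by (simp add: atoms_def)

lemma atoms_factor: "a * b \<in> atoms \<Longrightarrow> a \<in> units \<or> b \<in> units"
  by (auto simp: atoms_def)

lemma atoms_mult_unit: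
  fixes p :: "'a::ring_1_no_zero_divisors"
  assumes "p \<in> atoms" "u \<in> units"
  shows "p * u \<in> atoms" "u * p \<in> atoms"
proof -
  obtain v where v: "u * v = 1" "v * u = 1" using assms by (auto simp: units_def)
  have vu: "v \<in> units" "u \<noteq> 0" using v by (auto simp: units_def)
  have "a \<in> units \<or> b \<in> units" if "p * u = a * b" for a b
  proof -
    have "p = a * (b * v)" using that v by (metis mult.assoc mult_1_right)
    then show ?thesis using assms(1) atoms_factor units_mult_iff by metis
  qed
  then show "p * u \<in> atoms"
    using assms vu by (auto simp: atoms_def units_mult_iff)
  have "a \<in> units \<or> b \<in> units" if "u * p = a * b" for a b
  proof -
    have "p = (v * a) * b" using that v by (metis mult.assoc mult_1_left)
    then show ?thesis using assms(1) atoms_factor units_mult_iff by metis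
  qed
  then show "u * p \<in> atoms"
    using assms vu by (auto simp: atoms_def units_mult_iff)
qed

section \<open>Principal left ideals and Bezout relations\<close>

lemma left_ideal_iff: "x \<in> left_ideal a \<longleftrightarrow> (\<exists>r. x = r * a)"
  by (auto simp: left_ideal_def)

lemma left_ideal_self [simp]: "a \<in> left_ideal (a::'a::monoid_mult)"
  unfolding left_ideal_iff by (metis mult_1_left)

lemma left_ideal_subset_iff:
  fixes a b :: "'a::monoid_mult"
  shows "left_ideal a \<subseteq> left_ideal b \<longleftrightarrow> a \<in> left_ideal b"
proof
  assume "a \<in> left_ideal b"
  then obtain r where "a = r * b" by (auto simp: left_ideal_iff)
  then show "left_ideal a \<subseteq> left_ideal b"
    by (auto simp: left_ideal_iff) (metis mult.assoc)
qed auto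

lemma left_ideal_eq_UNIV_iff:
  fixes a :: "'a::ring_1_no_zero_divisors"
  shows "left_ideal a = UNIV \<longleftrightarrow> a \<in> units"
proof
  assume "left_ideal a = UNIV"
  then have "1 \<in> left_ideal a" by simp
  then show "a \<in> units" by (metis left_ideal_iff units_iff_left)
next
  assume "a \<in> units"
  then obtain v where "v * a = 1" by (auto simp: units_def)
  then have "x = (x * v) * a" for x by (simp add: mult.assoc)
  then show "left_ideal a = UNIV" using left_ideal_iff by blast
qed

lemma left_ideal_eq_associated:
  fixes a b :: "'a::ring_1_no_zero_divisors"
  assumes "left_ideal a = left_ideal b"
  obtains u where "u \<in> units" "a = u * b"
proof (cases "b = 0")
  case True
  then have "a = 0" using assms left_ideal_self[of a] by (auto simp: left_ideal_iff)
  then show ?thesis using True that[of 1] by simp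
next
  case False
  obtain u where u: "a = u * b" using assms left_ideal_self[of a] left_ideal_iff by blast
  obtain v where v: "b = v * a" using assms left_ideal_self[of b] left_ideal_iff by blast
  have "(v * u) * b = 1 * b" using u v by (simp add: mult.assoc)
  then have "v * u = 1" using False by (simp only: mult_cancel_right) simp
  then show ?thesis using that u units_iff_left by blast
qed

lemma zero_in_left_ideal [simp]: "(0::'a::ring_1) \<in> left_ideal a"
  unfolding left_ideal_iff by (metis mult_zero_left)

lemma left_ideal_plus_eq_UNIV_iff:
  fixes a b :: "'a::ring_1"
  shows "left_ideal a + left_ideal b = UNIV \<longleftrightarrow> (\<exists>s t. s * a + t * b = 1)"
proof
  assume "left_ideal a + left_ideal b = UNIV"
  then have "1 \<in> left_ideal a + left_ideal b" by simp
  then show "\<exists>s t. s * a + t * b = 1"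
    by (auto simp: set_plus_def left_ideal_iff) metis
next
  assume "\<exists>s t. s * a + t * b = 1"
  then obtain s t where st: "s * a + t * b = 1" by blast
  have "x \<in> left_ideal a + left_ideal b" for x
  proof -
    have "x = (x * s) * a + (x * t) * b"
      using st by (simp add: mult.assoc distrib_left [symmetric])
    moreover have "(x * s) * a \<in> left_ideal a" "(x * t) * b \<in> left_ideal b"
      unfolding left_ideal_iff by blast+
    ultimately show ?thesis by (metis set_plus_intro)
  qed
  then show "left_ideal a + left_ideal b = UNIV" by blast
qed

text \<open>Multiply a Bezout relation for \<open>u\<close>, \<open>v\<close> by the inverse of
  \<open>g\<close> on the left and by \<open>g\<close> on the right. This disposes of a greatest
  common divisor that is a unit.\<close>

lemma left_ideal_plus_mult_unit:
  fixes u v :: "'a::ring_1"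
  assumes "left_ideal u + left_ideal v = UNIV" "g \<in> units"
  shows "left_ideal (u * g) + left_ideal (v * g) = UNIV"
proof -
  obtain s t where st: "s * u + t * v = 1"
    using assms(1) unfolding left_ideal_plus_eq_UNIV_iff by blast
  obtain w where w: "w * g = 1" using assms(2) by (auto simp: units_def)
  have "(w * s) * (u * g) + (w * t) * (v * g) = w * (s * u + t * v) * g"
    by (simp add: algebra_simps)
  also have "\<dots> = 1" using st w by simp
  finally show ?thesis unfolding left_ideal_plus_eq_UNIV_iff by blast
qed

section \<open>Comaximal relations and the transfer of factorizations\<close>

text \<open>
  Cohn's comaximal relations: \<open>Ra + Rb = R\<close> and \<open>Ra \<inter> Rb = R b' a = R a' b \<noteq> 0\<close>. In this
  situation \<open>b\<close> and \<open>b'\<close> are similar, i.e. \<open>R/Rb \<cong> Ra/Rb'a \<cong> R/Rb'\<close>.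
\<close>

definition comax :: "'a::ring_1 \<Rightarrow> 'a \<Rightarrow> 'a \<Rightarrow> 'a \<Rightarrow> bool" where
  "comax a b b' a' \<longleftrightarrow>
     a \<noteq> 0 \<and> b \<noteq> 0 \<and> b' \<noteq> 0 \<and> a' \<noteq> 0 \<and> (\<exists>s t. s * a + t * b = 1) \<and> b' * a = a' * b \<and>
     (\<forall>x y. x * a = y * b \<longrightarrow> (\<exists>z. x = z * b' \<and> y = z * a'))"

lemma comax_commute: "comax a b b' a' \<longleftrightarrow> comax b a a' b'"
proof -
  have "comax b a a' b'" if "comax a b b' a'" for a b b' a' :: 'a
    using that unfolding comax_def by (metis add.commute)
  then show ?thesis by blast
qed

lemma right_ideal_iff: "x \<in> right_ideal a \<longleftrightarrow> (\<exists>r. x = a * r)"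
  by (auto simp: right_ideal_def)

text \<open>
  The left-right symmetry of the notion of 2-fir: the common multiple \<open>xa = yb\<close> shows that
  \<open>xR \<inter> yR \<noteq> 0\<close>, and dividing \<open>x, y\<close> by their left gcd yields \<open>0 \<rightarrow> R \<rightarrow> R\<^sup>2 \<rightarrow> R \<rightarrow> 0\<close>,
  which splits and can be dualized.
\<close>

lemma gcd_decomposition:
  fixes a b :: "'a::two_fir"
  assumes "x * a = y * b" "x * a \<noteq> 0"
  obtains g u v v' u' where "a = u * g" "b = v * g" "comax u v v' u'"
proof -
  have "x * a \<in> right_ideal x" "x * a \<in> right_ideal y"
    unfolding right_ideal_iff using assms(1) by blast+
  then have "right_ideal x \<inter> right_ideal y \<noteq> {0}" using assms(2) by blast
  then obtain c d where c: "right_ideal x \<inter> right_ideal y = right_ideal c"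
    and d: "{z + w |z w. z \<in> right_ideal x \<and> w \<in> right_ideal y} = right_ideal d"
    using two_fir[of x y] by auto
  have "x * 1 + y * 0 \<in> right_ideal d" "x * 0 + y * 1 \<in> right_ideal d"
    unfolding d [symmetric] right_ideal_iff by blast+
  then obtain p q where p: "x = d * p" and q: "y = d * q"
    by (auto simp: right_ideal_iff)
  have nz: "x \<noteq> 0" "y \<noteq> 0" "a \<noteq> 0" "b \<noteq> 0" using assms by auto
  have pq0: "p \<noteq> 0" "q \<noteq> 0" and d0: "d \<noteq> 0" using nz p q by auto
  have "d \<in> right_ideal d" unfolding right_ideal_iff by (metis mult_1_right)
  then obtain e f where "d = x * e + y * f"
    unfolding d [symmetric] right_ideal_iff by blast
  \<comment> \<open>Cancelling the left gcd \<open>d\<close> leaves \<open>p\<close>,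
    \<open>q\<close> with pR + qR = R, so the map (z, w) -> pz - qw from R^2 to R has the section r
    -> (er, -fr).\<close>
  then have "d * (p * e + q * f) = d * 1" using p q by (simp add: distrib_left mult.assoc)
  then have ef: "p * e + q * f = 1" using d0 by (simp only: mult_cancel_left) simp
  obtain u v where cu: "c = x * u" and cv: "c = y * v"
  proof -
    have "c \<in> right_ideal c" unfolding right_ideal_iff by (metis mult_1_right)
    then have "c \<in> right_ideal x" "c \<in> right_ideal y" using c by auto
    then show ?thesis using that unfolding right_ideal_iff by blast
  qed
  have uv: "p * u = q * v"
  proof -
    have "d * (p * u) = d * (q * v)" using cu cv p q by (simp add: mult.assoc [symmetric])
    then show ?thesis using d0 by simp
  qed
  \<comment> \<open>Since cR is the intersection of xR and yR, the kernel of that map is free on (u,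
    v).\<close>
  have lcm: "\<exists>s. z = u * s \<and> w = v * s" if "p * z = q * w" for z w
  proof -
    have "x * z = y * w" using that p q by (simp add: mult.assoc)
    then have "x * z \<in> right_ideal x \<inter> right_ideal y"
      unfolding Int_iff right_ideal_iff by blast
    then obtain s where s: "x * z = c * s" unfolding c right_ideal_iff by blast
    then have "x * z = x * (u * s)" "y * w = y * (v * s)"
      using cu cv \<open>x * z = y * w\<close> by (simp_all add: mult.assoc [symmetric])
    then show ?thesis using nz by auto
  qed
  have "d * (p * a) = d * (q * b)" using assms p q by (simp add: mult.assoc)
  then have "p * a = q * b" using d0 by simp
  then obtain g where g: "a = u * g" "b = v * g" using lcm by blast
  have u0: "u \<noteq> 0" "v \<noteq> 0" using g nz by auto
  \<comment> \<open>Removing the component along the section from (1, 0) and, further down, from (0,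
    1) lands in the kernel. The coefficients \<open>s\<close>, \<open>s'\<close> over (u, v) form a
    retraction of R^2 onto the kernel, which is the Bezout relation \<open>co\<close>.\<close>
  have "p * (1 - e * p) = q * (f * p)"
  proof -
    have "(p * e + q * f) * p = p" using ef by simp
    then show ?thesis by (simp add: algebra_simps)
  qed
  then obtain s where s: "1 - e * p = u * s" "f * p = v * s" using lcm by blast
  have "p * (e * q) = q * (1 - f * q)"
  proof -
    have "(p * e + q * f) * q = q" using ef by simp
    then show ?thesis by (simp add: algebra_simps)
  qed
  then obtain s' where s': "e * q = u * s'" "1 - f * q = v * s'" using lcm by blast
  have "u * (s * u + s' * v) = (u * s) * u + (u * s') * v"
    by (simp add: distrib_left mult.assoc)
  also have "\<dots> = (1 - e * p) * u + e * q * v" by (simp only: s s')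
  also have "\<dots> = u * 1" using uv by (simp add: algebra_simps)
  finally have co: "s * u + s' * v = 1" using u0 by (simp only: mult_cancel_left) simp
  \<comment> \<open>The functional (\<alpha>, -\<beta>) vanishes on (u, v), hence on the kernel, so
    it factors through R^2 -> R; the factor \<open>z\<close> is its value at (e, -f).\<close>
  have "\<exists>z. \<alpha> = z * p \<and> \<beta> = z * q" if "\<alpha> * u = \<beta> * v" for \<alpha> \<beta>
  proof -
    have "\<alpha> * (1 - e * p) = \<beta> * (f * p)"
      unfolding s using that by (simp add: mult.assoc [symmetric])
    then have "\<alpha> = (\<alpha> * e + \<beta> * f) * p" by (simp add: algebra_simps)
    moreover have "\<alpha> * (e * q) = \<beta> * (1 - f * q)"
      unfolding s' using that by (simp add: mult.assoc [symmetric])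
    then have "\<beta> = (\<alpha> * e + \<beta> * f) * q" by (simp add: algebra_simps)
    ultimately show ?thesis by blast
  qed
  then have "comax u v p q"
    unfolding comax_def using co uv u0 pq0 by blast
  then show ?thesis using that g by blast
qed

text \<open>After cancelling the common right factor \<open>g\<close>, the relation
  \<open>x * a = y * b\<close> becomes \<open>x * u = y * v\<close>, so the lcm cofactors of
  \<open>u\<close>, \<open>v\<close> serve for \<open>a\<close>, \<open>b\<close> as well.\<close>

lemma comax_exists:
  fixes a b :: "'a::two_fir"
  assumes "s * a + t * b = 1" "x * a = y * b" "x * a \<noteq> 0"
  obtains b' a' where "comax a b b' a'"
proof -
  obtain g u v v' u' where g: "a = u * g" "b = v * g" "comax u v v' u'"
    using gcd_decomposition[OF assms(2,3)] .
  have "(s * u + t * v) * g = 1" using assms(1) g by (simp add: distrib_right mult.assoc)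
  then have "g \<noteq> 0" by auto
  have "\<exists>s t. s * a + t * b = 1" using assms(1) by blast
  moreover have "v' * a = u' * b"
    using g by (simp add: mult.assoc [symmetric] comax_def)
  moreover have "x * u = y * v" if "x * a = y * b" for x y
    using that g \<open>g \<noteq> 0\<close> by (simp add: mult.assoc [symmetric])
  then have "\<forall>x y. x * a = y * b \<longrightarrow> (\<exists>z. x = z * v' \<and> y = z * u')"
    using g(3) unfolding comax_def by blast
  ultimately have "comax a b v' u'"
    using g \<open>g \<noteq> 0\<close> by (simp add: comax_def)
  then show ?thesis using that by blast
qed

text \<open>Complete the square of \<open>a\<close> with the inner factor \<open>g\<close> first;
  the resulting \<open>a1\<close> then takes the place of \<open>a\<close> against \<open>c\<close>.
  Pasting the two squares recovers the given one, so a factorization of \<open>b\<close> becomes one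
  of \<open>b'\<close>.\<close>

lemma comax_factor_right:
  fixes a :: "'a::two_fir"
  assumes "comax a (c * g) b' a'"
  obtains g' a1 c' where "b' = c' * g'" "comax a g g' a1" "comax a1 c c' a'"
proof -
  have nz: "a \<noteq> 0" "c \<noteq> 0" "g \<noteq> 0" "b' \<noteq> 0" "a' \<noteq> 0"
    and eq: "b' * a = (a' * c) * g"
    using assms by (auto simp: comax_def mult.assoc)
  obtain s t where st: "s * a + t * (c * g) = 1" using assms by (auto simp: comax_def)
  then have "s * a + (t * c) * g = 1" by (simp add: mult.assoc)
  moreover have "b' * a \<noteq> 0" using nz by simp
  ultimately obtain g' a1 where g': "comax a g g' a1" using comax_exists[OF _ eq] by blast
  then have nz': "g' \<noteq> 0" "a1 \<noteq> 0" and eq1: "g' * a = a1 * g" by (auto simp: comax_def)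
  obtain c' where c': "b' = c' * g'" "a' * c = c' * a1"
    using g' eq unfolding comax_def by blast
  \<comment> \<open>Multiplying the Bezout relation by \<open>g\<close> on the left exhibits
    \<open>1 - g * t * c\<close> as the cofactor of \<open>g\<close> in a common multiple of
    \<open>a\<close> and \<open>g\<close>, hence as a left multiple of \<open>a1\<close>. This is
    Bezout for \<open>a1\<close> and \<open>c\<close>.\<close>
  have "(g * s) * a = (1 - g * t * c) * g"
  proof -
    have "g * (s * a + t * (c * g)) = g" using st by simp
    then show ?thesis by (simp add: algebra_simps)
  qed
  then obtain z where "1 - g * t * c = z * a1" using g' unfolding comax_def by blast
  then have "z * a1 + (g * t) * c = 1" by (simp add: algebra_simps)
  moreover have "\<exists>z. x = z * c' \<and> y = z * a'" if xy: "x * a1 = y * c" for x y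
  proof -
    have "(x * g') * a = y * (c * g)"
      using xy eq1 by (simp add: mult.assoc) (simp add: mult.assoc [symmetric])
    then obtain w where "x * g' = w * b'" "y = w * a'"
      using assms unfolding comax_def by blast
    then show ?thesis using c' nz' by (auto simp: mult.assoc [symmetric])
  qed
  ultimately have "comax a1 c c' a'"
    using nz nz' c' unfolding comax_def by force
  then show ?thesis using that c' g' by blast
qed

text \<open>The transfer in the opposite direction, from \<open>b'\<close> to \<open>b\<close>. The
  inner factor \<open>g\<close> is obtained as the greatest common right divisor of \<open>b\<close>
  and \<open>g' * a\<close>.\<close>

lemma comax_factor_left:
  fixes a :: "'a::two_fir"
  assumes "comax a b (c' * g') a'"
  obtains g a1 c where "b = c * g" "comax a g g' a1" "comax a1 c c' a'"
proof -
  have nz: "a \<noteq> 0" "b \<noteq> 0" "c' \<noteq> 0" "g' \<noteq> 0" "a' \<noteq> 0"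
    and eq: "a' * b = c' * (g' * a)"
    using assms by (auto simp: comax_def mult.assoc)
  obtain s t where st: "s * a + t * b = 1" using assms by (auto simp: comax_def)
  obtain g c a1 k1 k2 where g: "b = c * g" "g' * a = a1 * g" "comax c a1 k1 k2"
    using gcd_decomposition[OF eq] nz by (metis mult_eq_0_iff)
  have nz': "g \<noteq> 0" "c \<noteq> 0" "a1 \<noteq> 0" using g nz by auto
  obtain e f where ef: "e * c + f * a1 = 1" using g by (auto simp: comax_def)
  \<comment> \<open>Writing \<open>g = e * b + f * g' * a\<close> and moving the last term to the
    left gives a relation between \<open>a\<close> and \<open>b\<close>, so the cofactor of
    \<open>a\<close> in it is a left multiple of \<open>c' * g'\<close>.\<close>
  have "\<exists>z. x = z * g' \<and> y = z * a1" if xy: "x * a = y * g" for x y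
  proof -
    have "y * g = y * (e * c + f * a1) * g" using ef by simp
    then have "(x - y * f * g') * a = (y * e) * b"
      using xy g by (simp add: algebra_simps)
    then obtain w where "x - y * f * g' = w * (c' * g')"
      using assms unfolding comax_def by blast
    then have x: "x = (y * f + w * c') * g'" by (simp add: algebra_simps)
    then have "y * g = (y * f + w * c') * (g' * a)" using xy by (simp add: mult.assoc)
    then have "y * g = ((y * f + w * c') * a1) * g" using g by (simp add: mult.assoc)
    then have "y = (y * f + w * c') * a1" using nz' by (simp only: mult_cancel_right) simp
    then show ?thesis using x by blast
  qed
  moreover have "s * a + (t * c) * g = 1" using st g by (simp add: mult.assoc)
  ultimately have 1: "comax a g g' a1"
    unfolding comax_def using nz nz' g(2) by blast
  have "(c' * a1) * g = (a' * c) * g" using eq g by (simp add: mult.assoc)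
  then have "c' * a1 = a' * c" using nz' by simp
  moreover have "\<exists>z. x = z * c' \<and> y = z * a'" if xy: "x * a1 = y * c" for x y
  proof -
    have "(x * g') * a = y * b"
      using xy g by (simp add: mult.assoc) (simp add: mult.assoc [symmetric])
    then obtain w where "x * g' = w * (c' * g')" "y = w * a'"
      using assms unfolding comax_def by blast
    then show ?thesis using nz by (auto simp: mult.assoc [symmetric])
  qed
  moreover have "f * a1 + e * c = 1" using ef by (simp add: add.commute)
  ultimately have 2: "comax a1 c c' a'" unfolding comax_def using nz nz' by blast
  show ?thesis using that 1 2 g by blast
qed

text \<open>If \<open>b\<close> is a unit, then \<open>a\<close> itself is an lcm of
  \<open>a\<close> and \<open>b\<close>. If \<open>b'\<close> is a unit, then \<open>a\<close> lies
  in Rb, and by Bezout so does 1.\<close>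

lemma comax_units_iff:
  fixes a :: "'a::two_fir"
  assumes "comax a b b' a'"
  shows "b \<in> units \<longleftrightarrow> b' \<in> units"
proof
  assume "b \<in> units"
  then obtain v where "v * b = 1" by (auto simp: units_def)
  then have "1 * a = (a * v) * b" by (simp add: mult.assoc)
  then have "\<exists>z. 1 = z * b'" using assms unfolding comax_def by blast
  then show "b' \<in> units" by (metis units_iff_left)
next
  assume "b' \<in> units"
  then obtain v where "v * b' = 1" by (auto simp: units_def)
  moreover have "b' * a = a' * b" using assms by (simp add: comax_def)
  ultimately have a: "a = v * a' * b" by (metis mult.assoc mult_1_left)
  obtain s t where "s * a + t * b = 1" using assms by (auto simp: comax_def)
  then have "(s * v * a' + t) * b = 1" using a by (simp add: distrib_right mult.assoc)
  then show "b \<in> units" by (auto simp: units_iff_left)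
qed

text \<open>The two transfer lemmas preserve which factors are units, so one side splits
  nontrivially exactly when the other does.\<close>

lemma comax_atoms_iff:
  fixes a :: "'a::two_fir"
  assumes "comax a b b' a'"
  shows "b \<in> atoms \<longleftrightarrow> b' \<in> atoms"
proof
  assume b: "b \<in> atoms"
  have "x \<in> units \<or> y \<in> units" if "b' = x * y" for x y
  proof -
    obtain g a1 c where "b = c * g" "comax a g y a1" "comax a1 c x a'"
      using comax_factor_left assms \<open>b' = x * y\<close> by metis
    then show ?thesis using b atoms_factor comax_units_iff by metis
  qed
  then show "b' \<in> atoms"
    using assms b comax_units_iff[OF assms] by (auto simp: atoms_def comax_def)
next
  assume b: "b' \<in> atoms"
  have "x \<in> units \<or> y \<in> units" if "b = x * y" for x y
  proof -
    obtain g' a1 c' where "b' = c' * g'" "comax a y g' a1" "comax a1 x c' a'"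
      using comax_factor_right assms \<open>b = x * y\<close> by metis
    then show ?thesis using b atoms_factor comax_units_iff by metis
  qed
  then show "b \<in> atoms"
    using assms b comax_units_iff[OF assms] by (auto simp: atoms_def comax_def)
qed

section \<open>Factorization lengths and their uniqueness\<close>

text \<open>A relation, since uniqueness of the length is only established in
  \<open>has_len_unique\<close>. The base case admits every unit, and atoms are split off on the
  right, where they generate left ideals containing the element.\<close>

inductive has_len :: "nat \<Rightarrow> 'a::ring_1 \<Rightarrow> bool" where
  has_len_unit: "u \<in> units \<Longrightarrow> has_len 0 u"
| has_len_Suc: "has_len n x \<Longrightarrow> p \<in> atoms \<Longrightarrow> has_len (Suc n) (x * p)"

lemma has_len_0_iff: "has_len 0 a \<longleftrightarrow> a \<in> units"
  by (auto intro: has_len_unit elim: has_len.cases)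

lemma has_len_SucE:
  assumes "has_len (Suc n) a"
  obtains x p where "a = x * p" "has_len n x" "p \<in> atoms"
  using assms by (cases rule: has_len.cases) auto

lemma has_len_nonzero:
  fixes a :: "'a::ring_1_no_zero_divisors"
  shows "has_len n a \<Longrightarrow> a \<noteq> 0"
  by (induction rule: has_len.induct) (auto simp: atoms_nonzero)

lemma has_len_unit_iff:
  fixes a :: "'a::ring_1_no_zero_divisors"
  shows "has_len n a \<Longrightarrow> a \<in> units \<longleftrightarrow> n = 0"
  by (cases rule: has_len.cases) (auto simp: units_mult_iff atoms_not_unit)

lemma has_len_mult:
  fixes a b :: "'a::ring_1_no_zero_divisors"
  assumes "has_len i a" "has_len j b"
  shows "has_len (i + j) (a * b)"
  using assms(2)
proof (induction rule: has_len.induct)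
  case (has_len_unit u)
  from assms(1) show ?case
  proof (cases rule: has_len.cases)
    case has_len_unit
    then show ?thesis using \<open>u \<in> units\<close> by (simp add: has_len_0_iff units_mult_iff)
  next
    case (has_len_Suc n x p)
    \<comment> \<open>A unit on the right is absorbed into the last atom.\<close>
    then have "has_len (Suc n) (x * (p * u))"
      using \<open>u \<in> units\<close> by (intro has_len.has_len_Suc atoms_mult_unit)
    then show ?thesis using has_len_Suc by (simp add: mult.assoc)
  qed
next
  case (has_len_Suc n x p)
  then show ?case using has_len.has_len_Suc[of "i + n" "a * x" p] by (simp add: mult.assoc)
qed

lemma has_len_atom: "p \<in> atoms \<Longrightarrow> has_len 1 p"
  using has_len_Suc[OF has_len_unit[OF one_in_units]] by fastforce

text \<open>Generators of an intersection are determined only up to a unit on the left, which does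
  not affect the length.\<close>

lemma has_len_left_ideal_cong:
  fixes a b :: "'a::ring_1_no_zero_divisors"
  assumes "has_len n a" "left_ideal b = left_ideal a"
  shows "has_len n b"
proof -
  obtain u where "u \<in> units" "b = u * a" using left_ideal_eq_associated assms(2) .
  then show ?thesis using has_len_mult[of 0 u n a] assms(1) by (simp add: has_len_0_iff)
qed

text \<open>Splitting off an atom on either side by the transfer lemmas leaves a square with
  \<open>a1\<close> in place of \<open>a\<close>, so the induction has to run over all
  squares.\<close>

lemma comax_has_len_iff:
  fixes a :: "'a::two_fir"
  assumes "comax a b b' a'"
  shows "has_len n b \<longleftrightarrow> has_len n b'"
  using assms
proof (induction n arbitrary: a b b' a')
  case 0
  then show ?case using comax_units_iff by (auto simp: has_len_0_iff)
next
  case (Suc n)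
  show ?case
  proof
    assume "has_len (Suc n) b"
    then obtain x p where xp: "b = x * p" "has_len n x" "p \<in> atoms" by (rule has_len_SucE)
    then obtain g' a1 c' where *: "b' = c' * g'" "comax a p g' a1" "comax a1 x c' a'"
      using comax_factor_right Suc.prems by metis
    have "has_len n c'" "g' \<in> atoms" using * xp Suc.IH comax_atoms_iff by metis+
    then show "has_len (Suc n) b'" using *(1) has_len_Suc by blast
  next
    assume "has_len (Suc n) b'"
    then obtain x p where xp: "b' = x * p" "has_len n x" "p \<in> atoms" by (rule has_len_SucE)
    then obtain g a1 c where *: "b = c * g" "comax a g p a1" "comax a1 c x a'"
      using comax_factor_left Suc.prems by metis
    have "has_len n c" "g \<in> atoms" using * xp Suc.IH comax_atoms_iff by metis+
    then show "has_len (Suc n) b" using *(1) has_len_Suc by blast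
  qed
qed

text \<open>Rp is maximal among the proper principal left ideals: the right gcd \<open>g\<close> of
  \<open>c\<close> and \<open>p\<close> is a unit or generates Rp, and the second case is excluded
  because \<open>c\<close> lies outside Rp. The nonzero common multiple makes the gcd
  available.\<close>

lemma atom_comax:
  fixes c p :: "'a::two_fir"
  assumes "p \<in> atoms" "x * c = y * p" "x * c \<noteq> 0" "c \<notin> left_ideal p"
  obtains p' c' where "comax c p p' c'"
proof -
  obtain g u v v' u' where g: "c = u * g" "p = v * g" "comax u v v' u'"
    using gcd_decomposition[OF assms(2,3)] .
  have "v \<notin> units"
  proof
    assume "v \<in> units"
    then obtain w where "w * v = 1" by (auto simp: units_def)
    then have "c = (u * w) * p" using g by (metis mult.assoc mult_1_left)
    then show False using assms(4) by (auto simp: left_ideal_iff)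
  qed
  then have "g \<in> units" using assms(1) g(2) atoms_factor by blast
  moreover have "left_ideal u + left_ideal v = UNIV"
    using g(3) unfolding left_ideal_plus_eq_UNIV_iff comax_def by blast
  ultimately obtain s t where "s * c + t * p = 1"
    using left_ideal_plus_mult_unit g(1,2) left_ideal_plus_eq_UNIV_iff by metis
  then show ?thesis using comax_exists[OF _ assms(2,3)] that by blast
qed

text \<open>Split off the last atom \<open>q\<close> of the product. Either \<open>q\<close> divides
  \<open>c\<close> on the right and cancels, or \<open>c\<close> and \<open>q\<close> are comaximal.
  Then \<open>b * c\<close> is a left multiple of their lcm, and the atom moves past
  \<open>c\<close> into \<open>b\<close>, as \<open>q'\<close>.\<close>

lemma has_len_factor:
  fixes b c :: "'a::two_fir"
  assumes "has_len n (b * c)"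
  shows "\<exists>i j. has_len i b \<and> has_len j c \<and> n = i + j"
  using assms
proof (induction n arbitrary: b c)
  case 0
  then show ?case by (auto simp: has_len_0_iff units_mult_iff)
next
  case (Suc n)
  obtain a' q where q: "b * c = a' * q" "has_len n a'" "q \<in> atoms"
    using Suc.prems by (rule has_len_SucE)
  show ?case
  proof (cases "c \<in> left_ideal q")
    case True
    then obtain c' where c': "c = c' * q" by (auto simp: left_ideal_iff)
    then have "(b * c') * q = a' * q" using q by (simp add: mult.assoc)
    then have "a' = b * c'" using q(3) atoms_nonzero by auto
    then obtain i j where "has_len i b" "has_len j c'" "n = i + j" using Suc.IH q(2) by blast
    then show ?thesis using c' q(3) has_len_Suc by (metis add_Suc_right)
  next
    case False
    have "b * c \<noteq> 0" using Suc.prems has_len_nonzero by blast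
    then obtain q' c' where co: "comax c q q' c'" using atom_comax q False by metis
    then obtain r where r: "b = r * q'" "a' = r * c'" using q(1) unfolding comax_def by blast
    then obtain i j where ij: "has_len i r" "has_len j c'" "n = i + j"
      using Suc.IH q(2) by blast
    \<comment> \<open>With the roles of \<open>c\<close> and \<open>q\<close> exchanged, the same
      square makes \<open>c\<close> and \<open>c'\<close> similar.\<close>
    have "has_len j c" using ij co comax_commute comax_has_len_iff by metis
    moreover have "has_len (Suc i) b"
      using r ij q(3) co comax_atoms_iff has_len_Suc by metis
    ultimately show ?thesis using ij by (metis add_Suc)
  qed
qed

text \<open>The factorizations are not compared atom by atom: \<open>has_len_factor\<close>
  distributes the length \<open>Suc n\<close> over \<open>x * p\<close>, where the atom
  \<open>p\<close> takes exactly one, and \<open>x\<close> falls to the induction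
  hypothesis.\<close>

lemma has_len_unique:
  fixes a :: "'a::two_fir"
  assumes "has_len n a" "has_len m a"
  shows "n = m"
  using assms
proof (induction n arbitrary: a m)
  case 0
  then show ?case using has_len_unit_iff has_len_0_iff by metis
next
  case (Suc n)
  have "m \<noteq> 0" using Suc.prems has_len_unit_iff by (metis nat.distinct(1))
  then obtain k where k: "m = Suc k" by (cases m) auto
  obtain x p where xp: "a = x * p" "has_len k x" "p \<in> atoms"
    using Suc.prems(2) k has_len_SucE by metis
  obtain i j where ij: "has_len i x" "has_len j p" "Suc n = i + j"
    using has_len_factor Suc.prems(1) xp(1) by metis
  have "j = 1"
  proof -
    have "j \<noteq> 0" using ij xp atoms_not_unit has_len_0_iff by metis
    then obtain l where l: "j = Suc l" by (cases j) auto
    then obtain y q where "p = y * q" "has_len l y" "q \<in> atoms"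
      using ij(2) has_len_SucE by metis
    then show ?thesis using xp(3) l atoms_factor atoms_not_unit has_len_unit_iff by (metis One_nat_def)
  qed
  then have "has_len n x" using ij by simp
  then show ?case using Suc.IH xp k by blast
qed

lemma has_len_prod_list:
  fixes ps :: "'a::ring_1_no_zero_divisors list"
  shows "set ps \<subseteq> atoms \<Longrightarrow> has_len (length ps) (prod_list ps)"
proof (induction ps)
  case Nil
  then show ?case by (simp add: has_len_0_iff)
next
  case (Cons p ps)
  then show ?case using has_len_mult[OF has_len_atom, of p "length ps" "prod_list ps"] by simp
qed

text \<open>Length 0 is excluded because a unit other than 1 is no product of atoms; in positive
  length the unit is absorbed into the first atom.\<close>

lemma has_len_prod_listE:
  fixes a :: "'a::ring_1_no_zero_divisors"
  assumes "has_len n a" "n \<noteq> 0"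
  obtains ps where "set ps \<subseteq> atoms" "length ps = n" "prod_list ps = a"
proof -
  have "n = 0 \<or> (\<exists>ps. set ps \<subseteq> atoms \<and> length ps = n \<and> prod_list ps = a)"
    using assms(1)
  proof (induction rule: has_len.induct)
    case (has_len_Suc n x p)
    show ?case
    proof (cases "n = 0")
      case True
      then have "x * p \<in> atoms" using has_len_Suc by (simp add: has_len_0_iff atoms_mult_unit)
      then show ?thesis using True by (intro disjI2 exI[of _ "[x * p]"]) simp
    next
      case False
      then obtain ps where "set ps \<subseteq> atoms" "length ps = n" "prod_list ps = x"
        using has_len_Suc by auto
      then show ?thesis using has_len_Suc by (intro disjI2 exI[of _ "ps @ [p]"]) simp
    qed
  qed simp
  then show ?thesis using assms that by blast
qed

lemma len_eq:
  fixes a :: "'a::two_fir"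
  assumes "has_len n a"
  shows "len a = enat n"
proof (cases "a \<in> units")
  case True
  then show ?thesis using assms has_len_unit_iff by (fastforce simp: len_def zero_enat_def)
next
  case False
  then have "n \<noteq> 0" using assms has_len_unit_iff by blast
  then obtain ps where ps: "set ps \<subseteq> atoms" "length ps = n" "prod_list ps = a"
    using assms has_len_prod_listE by metis
  have "length qs = n" if "set qs \<subseteq> atoms" "a = prod_list qs" for qs
    using that assms has_len_prod_list has_len_unique by metis
  then have "{enat (length ps) |ps. set ps \<subseteq> atoms \<and> a = prod_list ps} = {enat n}"
    using ps by blast
  then show ?thesis using False by (simp add: len_def)
qed

lemma finite_len_iff:
  fixes a :: "'a::two_fir"
  shows "a \<in> finite_len \<longleftrightarrow> (\<exists>n. has_len n a)"
proof
  assume a: "a \<in> finite_len"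
  show "\<exists>n. has_len n a"
  proof (cases "a \<in> units")
    case True
    then show ?thesis using has_len_unit by blast
  next
    case False
    let ?S = "{enat (length ps) |ps. set ps \<subseteq> atoms \<and> a = prod_list ps}"
    have "?S \<noteq> {}"
    proof
      assume "?S = {}"
      then have "len a = \<infinity>" using False by (simp add: len_def Inf_enat_def)
      then show False using a by (simp add: finite_len_def)
    qed
    then show ?thesis using has_len_prod_list by blast
  qed
next
  assume "\<exists>n. has_len n a"
  then show "a \<in> finite_len" using len_eq by (auto simp: finite_len_def)
qed

section \<open>Lengths of gcd and lcm, and part c)\<close>

lemma comax_Int_left_ideal:
  fixes a b :: "'a::ring_1"
  assumes "comax a b b' a'"
  shows "left_ideal a \<inter> left_ideal b = left_ideal (b' * a)"
proof
  show "left_ideal a \<inter> left_ideal b \<subseteq> left_ideal (b' * a)"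
  proof
    fix z
    assume "z \<in> left_ideal a \<inter> left_ideal b"
    then obtain x y where xy: "z = x * a" "z = y * b" unfolding Int_iff left_ideal_iff by blast
    then obtain w where "x = w * b'" using assms unfolding comax_def by metis
    then show "z \<in> left_ideal (b' * a)" using xy unfolding left_ideal_iff by (metis mult.assoc)
  qed
  have "b' * a \<in> left_ideal a" "b' * a \<in> left_ideal b"
    using assms unfolding comax_def left_ideal_iff by blast+
  then show "left_ideal (b' * a) \<subseteq> left_ideal a \<inter> left_ideal b"
    unfolding Int_subset_iff left_ideal_subset_iff by blast
qed

lemma left_ideal_mult_right_mono:
  fixes a b :: "'a::ring_1"
  assumes "a \<in> left_ideal b"
  shows "a * c \<in> left_ideal (b * c)"
  using assms unfolding left_ideal_iff by (metis mult.assoc)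

lemma Int_left_ideal_nonzeroE:
  fixes a b :: "'a::ring_1"
  assumes "left_ideal a \<inter> left_ideal b \<noteq> {0}"
  obtains x y where "x * a = y * b" "x * a \<noteq> 0"
proof -
  have "0 \<in> left_ideal a \<inter> left_ideal b" by simp
  then obtain z where z: "z \<in> left_ideal a" "z \<in> left_ideal b" "z \<noteq> 0" using assms by blast
  then obtain x y where "z = x * a" "z = y * b" unfolding left_ideal_iff by blast
  then show ?thesis using that z(3) by metis
qed

text \<open>With \<open>a = u * g\<close> and \<open>b = v * g\<close> the lcm is
  \<open>v' * a\<close>, and \<open>v'\<close> has the length of \<open>v\<close> by similarity. The
  clauses on \<open>g\<close> record what part c) needs to know about the gcd.\<close>

lemma has_len_lcm:
  fixes a b :: "'a::two_fir"
  assumes "has_len i a" "has_len j b" "left_ideal a \<inter> left_ideal b = left_ideal m"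
    and "left_ideal a \<inter> left_ideal b \<noteq> {0}"
  shows "\<exists>g k l. k + l = i + j \<and> has_len k g \<and> has_len l m \<and>
    a \<in> left_ideal g \<and> b \<in> left_ideal g \<and>
    (g \<in> units \<longrightarrow> left_ideal a + left_ideal b = UNIV)"
proof -
  obtain x y where xy: "x * a = y * b" "x * a \<noteq> 0" using Int_left_ideal_nonzeroE assms(4) .
  obtain g u v v' u' where g: "a = u * g" "b = v * g" and co: "comax u v v' u'"
    using gcd_decomposition[OF xy] .
  obtain i' k where i: "has_len i' u" "has_len k g" "i = i' + k"
    using has_len_factor assms(1) g(1) by metis
  obtain j' k' where j: "has_len j' v" "has_len k' g" "j = j' + k'"
    using has_len_factor assms(2) g(2) by metis
  have "k' = k" using has_len_unique i j by metis
  have "has_len j' v'" using comax_has_len_iff[OF co] j by simp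
  then have len: "has_len (j' + i) (v' * a)" using has_len_mult assms(1) by blast
  have "g \<noteq> 0" using i has_len_nonzero by blast
  \<comment> \<open>Cancelling \<open>g\<close> reduces this to the intersection for
    \<open>u\<close> and \<open>v\<close>.\<close>
  have "left_ideal a \<inter> left_ideal b = left_ideal (v' * a)"
  proof
    show "left_ideal a \<inter> left_ideal b \<subseteq> left_ideal (v' * a)"
    proof
      fix z
      assume "z \<in> left_ideal a \<inter> left_ideal b"
      then obtain r s where rs: "z = r * a" "z = s * b" unfolding Int_iff left_ideal_iff by blast
      then have "(r * u) * g = (s * v) * g" using g by (simp add: mult.assoc)
      then have "r * u = s * v" using \<open>g \<noteq> 0\<close> by simp
      then have "r * u \<in> left_ideal u \<inter> left_ideal v"
        unfolding Int_iff left_ideal_iff by blast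
      then have "r * u * g \<in> left_ideal (v' * u * g)"
        using comax_Int_left_ideal[OF co] left_ideal_mult_right_mono by blast
      then show "z \<in> left_ideal (v' * a)" using rs g by (simp add: mult.assoc)
    qed
    have "v' * a = u' * b" using co g by (simp add: comax_def mult.assoc [symmetric])
    then have "v' * a \<in> left_ideal a" "v' * a \<in> left_ideal b"
      unfolding left_ideal_iff by blast+
    then show "left_ideal (v' * a) \<subseteq> left_ideal a \<inter> left_ideal b"
      unfolding Int_subset_iff left_ideal_subset_iff by blast
  qed
  then have "has_len (j' + i) m" using has_len_left_ideal_cong[OF len] assms(3) by simp
  moreover have "k + (j' + i) = i + j" using i j \<open>k' = k\<close> by simp
  moreover have "left_ideal a + left_ideal b = UNIV" if unit: "g \<in> units"
  proof -
    obtain s t where "s * u + t * v = 1" using co by (auto simp: comax_def)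
    then have "left_ideal u + left_ideal v = UNIV"
      unfolding left_ideal_plus_eq_UNIV_iff by blast
    then show ?thesis using g left_ideal_plus_mult_unit[OF _ unit] by blast
  qed
  moreover have "a \<in> left_ideal g" "b \<in> left_ideal g" using g unfolding left_ideal_iff by blast+
  ultimately show ?thesis using i by blast
qed

lemma not_comaximal_common_divisor:
  fixes a b :: "'a::ring_1_no_zero_divisors"
  assumes "a \<in> left_ideal g" "b \<in> left_ideal g" "g \<notin> units"
  shows "left_ideal a + left_ideal b \<noteq> UNIV"
proof
  assume "left_ideal a + left_ideal b = UNIV"
  then obtain s t where st: "s * a + t * b = 1" unfolding left_ideal_plus_eq_UNIV_iff by blast
  obtain u v where "a = u * g" "b = v * g" using assms unfolding left_ideal_iff by blast
  then have "(s * u + t * v) * g = 1" using st by (simp add: distrib_right mult.assoc)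
  then show False using assms(3) units_iff_left by blast
qed

lemma mem_left_ideal_trans:
  fixes a b c :: "'a::monoid_mult"
  shows "a \<in> left_ideal b \<Longrightarrow> b \<in> left_ideal c \<Longrightarrow> a \<in> left_ideal c"
  using left_ideal_subset_iff by blast

text \<open>All three conditions say that the gcd \<open>g\<close> is a unit: a non-unit
  \<open>g\<close> has a last atom, which lies in both \<open>V a\<close> and \<open>V b\<close>,
  and the lcm has length \<open>i + j\<close> exactly when \<open>g\<close> has length 0.\<close>

lemma V_disjoint_iff:
  fixes a b m :: "'a::two_fir"
  assumes "a \<in> finite_len" "b \<in> finite_len"
    and "left_ideal a \<inter> left_ideal b = left_ideal m" "left_ideal a \<inter> left_ideal b \<noteq> {0}"
  shows "V a \<inter> V b = {} \<longleftrightarrow> left_ideal a + left_ideal b = UNIV"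
    and "left_ideal a + left_ideal b = UNIV \<longleftrightarrow> len m = len a + len b"
proof -
  obtain i j where ij: "has_len i a" "has_len j b" using assms finite_len_iff by metis
  obtain g k l where g: "k + l = i + j" "has_len k g" "has_len l m"
    "a \<in> left_ideal g" "b \<in> left_ideal g"
    "g \<in> units \<Longrightarrow> left_ideal a + left_ideal b = UNIV"
    using has_len_lcm[OF ij assms(3,4)] by blast
  have co: "left_ideal a + left_ideal b = UNIV \<longleftrightarrow> g \<in> units"
    using g not_comaximal_common_divisor by blast
  have "V a \<inter> V b = {}" if "left_ideal a + left_ideal b = UNIV"
    using that not_comaximal_common_divisor[of a _ b] atoms_not_unit by (auto simp: V_def)
  moreover have "V a \<inter> V b \<noteq> {}" if "g \<notin> units"
  proof -
    have "k \<noteq> 0" using that g(2) has_len_unit_iff by blast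
    then obtain k' where "k = Suc k'" by (cases k) auto
    then obtain x p where "g = x * p" "p \<in> atoms" using g(2) has_len_SucE by metis
    then have "g \<in> left_ideal p" "p \<in> atoms" unfolding left_ideal_iff by blast+
    then have "p \<in> V a \<inter> V b" using g(4,5) mem_left_ideal_trans by (auto simp: V_def)
    then show ?thesis by blast
  qed
  ultimately show "V a \<inter> V b = {} \<longleftrightarrow> left_ideal a + left_ideal b = UNIV" using co by blast
  have "g \<in> units \<longleftrightarrow> l = i + j" using has_len_unit_iff[OF g(2)] g(1) by arith
  then show "left_ideal a + left_ideal b = UNIV \<longleftrightarrow> len m = len a + len b"
    using co len_eq[OF g(3)] len_eq[OF ij(1)] len_eq[OF ij(2)] by simp
qed

section \<open>Dependence of atoms as inclusion of left ideals\<close>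

lemma F_algebraic_iff:
  fixes D :: "'a::two_fir set"
  assumes "D \<subseteq> atoms"
  shows "F_algebraic D \<longleftrightarrow> (\<exists>c. c \<noteq> 0 \<and> (\<forall>d\<in>D. c \<in> left_ideal d))"
proof -
  have "D \<subseteq> finite_len - units"
    using assms has_len_atom atoms_not_unit finite_len_iff by blast
  moreover have "0 \<in> (\<Inter>d\<in>D. left_ideal d)" by simp
  then have "(\<Inter>d\<in>D. left_ideal d) \<noteq> {0} \<longleftrightarrow> (\<exists>c. c \<noteq> 0 \<and> c \<in> (\<Inter>d\<in>D. left_ideal d))"
    by blast
  ultimately show ?thesis by (simp add: F_algebraic_def)
qed

text \<open>By \<open>atom_comax\<close> the lcm is \<open>p' * m\<close> with \<open>p'\<close>
  similar to \<open>p\<close>, hence an atom. The rank computations rest on this increase by exactly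
  one.\<close>

lemma atom_Int_left_ideal:
  fixes m p :: "'a::two_fir"
  assumes "p \<in> atoms" "has_len n m" "c \<noteq> 0" "c \<in> left_ideal m" "c \<in> left_ideal p"
    and "m \<notin> left_ideal p"
  obtains m' where "left_ideal m \<inter> left_ideal p = left_ideal m'" "has_len (Suc n) m'"
proof -
  obtain x y where "c = x * m" "c = y * p" using assms unfolding left_ideal_iff by blast
  then obtain p' m1 where co: "comax m p p' m1" using atom_comax assms by metis
  then have "has_len (1 + n) (p' * m)"
    using assms comax_atoms_iff has_len_atom has_len_mult by metis
  then show ?thesis using that comax_Int_left_ideal[OF co] by simp
qed

text \<open>Each further atom leaves the intersection unchanged or raises the length of its
  generator by one. The common multiple \<open>c\<close> keeps the intersections nonzero, so that
  the 2-fir condition applies.\<close>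

lemma finite_Inter_left_ideal:
  fixes G :: "'a::two_fir set"
  assumes "finite G" "G \<subseteq> atoms" "c \<noteq> 0" "\<And>g. g \<in> G \<Longrightarrow> c \<in> left_ideal g"
  shows "\<exists>m n. (\<Inter>g\<in>G. left_ideal g) = left_ideal m \<and> has_len n m \<and> n \<le> card G"
  using assms
proof (induction G rule: finite_induct)
  case empty
  have "left_ideal (1::'a) = UNIV" by (simp add: left_ideal_eq_UNIV_iff)
  then show ?case using has_len_unit[OF one_in_units] by force
next
  case (insert p G)
  then obtain m n where m: "(\<Inter>g\<in>G. left_ideal g) = left_ideal m" "has_len n m" "n \<le> card G"
    by auto
  have INT: "(\<Inter>g\<in>insert p G. left_ideal g) = left_ideal m \<inter> left_ideal p" using m(1) by auto
  show ?case
  proof (cases "m \<in> left_ideal p")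
    case True
    then have "left_ideal m \<inter> left_ideal p = left_ideal m" using left_ideal_subset_iff by blast
    then have "(\<Inter>g\<in>insert p G. left_ideal g) = left_ideal m" using INT by (rule trans [rotated])
    then show ?thesis using m insert.hyps by (metis card_insert_disjoint le_SucI)
  next
    case False
    have "c \<in> left_ideal m" unfolding m(1) [symmetric] using insert.prems by blast
    then obtain m' where "left_ideal m \<inter> left_ideal p = left_ideal m'" "has_len (Suc n) m'"
      using atom_Int_left_ideal[of p n m c] False m insert.prems by blast
    then show ?thesis using INT m(3) insert.hyps by (metis Suc_le_mono card_insert_disjoint)
  qed
qed

text \<open>For an atom \<open>p\<close>, \<open>Rp\<close> is maximal among the principal left ideals, so \<open>Rp + Rm \<noteq> R\<close>
  means \<open>Rm \<subseteq> Rp\<close>.\<close>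

lemma F_dependent_iff:
  fixes D :: "'a::two_fir set"
  assumes "D \<subseteq> atoms" "F_algebraic D" "p \<in> atoms"
  shows "F_dependent p D \<longleftrightarrow>
    (\<exists>G\<subseteq>D. finite G \<and> (\<Inter>g\<in>G. left_ideal g) \<subseteq> left_ideal p)"
proof
  assume dep: "F_dependent p D"
  then have "F_algebraic (D \<union> {p})" by (simp add: F_dependent_def)
  then obtain c where c: "c \<noteq> 0" "\<And>d. d \<in> D \<union> {p} \<Longrightarrow> c \<in> left_ideal d"
    using F_algebraic_iff[of "D \<union> {p}"] assms by auto
  obtain G where G: "G \<subseteq> D" "finite G" "left_ideal p + (\<Inter>g\<in>G. left_ideal g) \<noteq> UNIV"
    using dep by (auto simp: F_dependent_def)
  obtain m n where m: "(\<Inter>g\<in>G. left_ideal g) = left_ideal m" "has_len n m"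
    using finite_Inter_left_ideal[of G c] G assms(1) c by blast
  have "m \<in> left_ideal p"
  proof (rule ccontr)
    assume "m \<notin> left_ideal p"
    have "c \<in> left_ideal m" unfolding m(1) [symmetric] using c(2) G(1) by blast
    then obtain x y where "c = x * m" "c = y * p"
      using c(2)[of p] unfolding left_ideal_iff by blast
    then obtain p' m1 where "comax m p p' m1"
      using atom_comax \<open>m \<notin> left_ideal p\<close> assms(3) c(1) by metis
    then have "left_ideal m + left_ideal p = UNIV"
      unfolding left_ideal_plus_eq_UNIV_iff comax_def by blast
    then show False using G(3) m(1) by (metis add.commute)
  qed
  then show "\<exists>G\<subseteq>D. finite G \<and> (\<Inter>g\<in>G. left_ideal g) \<subseteq> left_ideal p"
    using G m left_ideal_subset_iff by metis
next
  assume "\<exists>G\<subseteq>D. finite G \<and> (\<Inter>g\<in>G. left_ideal g) \<subseteq> left_ideal p"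
  then obtain G where G: "G \<subseteq> D" "finite G" "(\<Inter>g\<in>G. left_ideal g) \<subseteq> left_ideal p" by blast
  obtain c where c: "c \<noteq> 0" "\<And>d. d \<in> D \<Longrightarrow> c \<in> left_ideal d"
    using F_algebraic_iff[of D] assms by blast
  \<comment> \<open>A nonzero common multiple of \<open>D\<close> is already one of
    \<open>p\<close>, so adjoining \<open>p\<close> keeps the set F-algebraic.\<close>
  then have "c \<in> left_ideal p" using G by blast
  then have alg: "F_algebraic (D \<union> {p})" using F_algebraic_iff[of "D \<union> {p}"] assms c by blast
  have "1 \<notin> left_ideal p + (\<Inter>g\<in>G. left_ideal g)"
  proof
    assume "1 \<in> left_ideal p + (\<Inter>g\<in>G. left_ideal g)"
    then obtain x y where xy: "1 = x + y" "x \<in> left_ideal p" "y \<in> left_ideal p"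
      using G(3) by (auto elim!: set_plus_elim)
    then obtain r s where "x = r * p" "y = s * p" unfolding left_ideal_iff by blast
    then have "(r + s) * p = 1" using xy(1) by (simp add: distrib_right)
    then show False using assms(3) atoms_not_unit units_iff_left by blast
  qed
  then have "left_ideal p + (\<Inter>g\<in>G. left_ideal g) \<noteq> UNIV" by blast
  then show "F_dependent p D"
    using assms alg G finite_len_iff has_len_atom unfolding F_dependent_def by blast
qed

lemma F_algebraic_subset:
  fixes D :: "'a::two_fir set"
  assumes "D \<subseteq> atoms" "F_algebraic D" "E \<subseteq> D"
  shows "F_algebraic E"
  using assms F_algebraic_iff[of D] F_algebraic_iff[of E] by blast

section \<open>Independence measured by length\<close>

lemma F_independent_iff:
  fixes D :: "'a::two_fir set"
  assumes "D \<subseteq> atoms"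
  shows "F_independent D \<longleftrightarrow> F_algebraic D \<and>
    (\<forall>d\<in>D. \<forall>G\<subseteq>D - {d}. finite G \<longrightarrow> \<not> (\<Inter>g\<in>G. left_ideal g) \<subseteq> left_ideal d)"
proof -
  have *: "F_dependent d (D - {d}) \<longleftrightarrow>
      (\<exists>G\<subseteq>D - {d}. finite G \<and> (\<Inter>g\<in>G. left_ideal g) \<subseteq> left_ideal d)"
    if "F_algebraic D" "d \<in> D" for d
    using that assms F_algebraic_subset[OF assms that(1), of "D - {d}"]
    by (intro F_dependent_iff) auto
  show ?thesis by (cases "F_algebraic D") (auto simp: F_independent_def *)
qed

lemma F_independent_subset:
  fixes D :: "'a::two_fir set"
  assumes "D \<subseteq> atoms" "F_independent D" "E \<subseteq> D"
  shows "F_independent E"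
proof -
  have E: "E \<subseteq> atoms" using assms by blast
  have "F_algebraic E"
    using assms F_algebraic_subset[of D E] by (simp add: F_independent_def)
  moreover have "\<not> (\<Inter>g\<in>G. left_ideal g) \<subseteq> left_ideal d"
    if "d \<in> E" "G \<subseteq> E - {d}" "finite G" for d G
  proof -
    have "d \<in> D" "G \<subseteq> D - {d}" using that assms(3) by auto
    then show ?thesis using that(3) assms(2) F_independent_iff[OF assms(1)] by blast
  qed
  ultimately show ?thesis using F_independent_iff[OF E] by blast
qed

text \<open>By independence the intersection over the earlier atoms is not contained in the ideal of
  the next one, so every atom raises the length by one.\<close>

lemma F_independent_has_len:
  fixes G :: "'a::two_fir set"
  assumes "finite G" "G \<subseteq> atoms" "F_independent G" "(\<Inter>g\<in>G. left_ideal g) = left_ideal m"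
  shows "has_len (card G) m"
  using assms
proof (induction G arbitrary: m rule: finite_induct)
  case empty
  then have "m \<in> units" using left_ideal_eq_UNIV_iff by auto
  then show ?case by (simp add: has_len_0_iff)
next
  case (insert p G)
  have "F_algebraic (insert p G)" using insert.prems by (simp add: F_independent_def)
  then obtain c where c: "c \<noteq> 0" "\<And>d. d \<in> insert p G \<Longrightarrow> c \<in> left_ideal d"
    using F_algebraic_iff[of "insert p G"] insert.prems by blast
  obtain l where l: "(\<Inter>g\<in>G. left_ideal g) = left_ideal l"
    using finite_Inter_left_ideal[of G c] c insert.hyps insert.prems by blast
  have "F_independent G" using F_independent_subset[of "insert p G" G] insert.prems by blast
  then have len: "has_len (card G) l" using insert.IH insert.prems l by blast
  have "G \<subseteq> insert p G - {p}" using insert.hyps by blast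
  then have "\<not> (\<Inter>g\<in>G. left_ideal g) \<subseteq> left_ideal p"
    using insert.prems(2) insert.hyps(1) F_independent_iff[OF insert.prems(1)] by blast
  then have "\<not> left_ideal l \<subseteq> left_ideal p" unfolding l .
  then have "l \<notin> left_ideal p" using left_ideal_subset_iff by blast
  moreover have "c \<in> left_ideal l" unfolding l [symmetric] using c by blast
  ultimately obtain m' where m': "left_ideal l \<inter> left_ideal p = left_ideal m'"
    "has_len (Suc (card G)) m'"
    using atom_Int_left_ideal[of p "card G" l c] len c insert.prems by blast
  have "left_ideal m = left_ideal m'" using insert.prems(3) l m'(1) by auto
  then show ?case using m' has_len_left_ideal_cong insert.hyps by simp
qed

text \<open>For the converse, a redundant \<open>g\<close> can be omitted without changing the
  intersection, whose generator then has length below \<open>card G\<close>, against uniqueness of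
  length.\<close>

lemma F_independent_iff_has_len:
  fixes G :: "'a::two_fir set"
  assumes "finite G" "G \<subseteq> atoms" "F_algebraic G" "(\<Inter>g\<in>G. left_ideal g) = left_ideal m"
  shows "F_independent G \<longleftrightarrow> has_len (card G) m"
proof
  assume len: "has_len (card G) m"
  have "\<not> (\<Inter>h\<in>H. left_ideal h) \<subseteq> left_ideal g"
    if g: "g \<in> G" and H: "H \<subseteq> G - {g}" for g H
  proof
    assume "(\<Inter>h\<in>H. left_ideal h) \<subseteq> left_ideal g"
    then have INT: "(\<Inter>h\<in>G - {g}. left_ideal h) = left_ideal m"
      unfolding assms(4) [symmetric] using g H by blast
    obtain c where c: "c \<noteq> 0" "\<And>g. g \<in> G \<Longrightarrow> c \<in> left_ideal g"
      using F_algebraic_iff[of G] assms by blast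
    obtain m' n where m': "(\<Inter>h\<in>G - {g}. left_ideal h) = left_ideal m'"
      "has_len n m'" "n \<le> card (G - {g})"
      using finite_Inter_left_ideal[of "G - {g}" c] c assms by blast
    then have "has_len n m" using INT has_len_left_ideal_cong by metis
    then have "n = card G" using has_len_unique len by blast
    moreover have "card (G - {g}) < card G" using assms(1) g by (rule card_Diff1_less)
    ultimately show False using m'(3) by simp
  qed
  then show "F_independent G" using F_independent_iff[of G] assms by blast
qed (use assms F_independent_has_len in blast)

text \<open>The lcm of a finite subset \<open>G\<close> divides \<open>c\<close> on the right and
  has length \<open>card G\<close>, which is therefore at most \<open>k\<close>. This uniform bound
  on finite subsets also forces \<open>D\<close> to be finite.\<close>

lemma F_independent_card_le:
  fixes D :: "'a::two_fir set"
  assumes "D \<subseteq> V c" "has_len k c" "F_independent D"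
  shows "finite D \<and> card D \<le> k"
proof (rule finite_if_finite_subsets_card_bdd)
  fix G
  assume G: "G \<subseteq> D" "finite G"
  have D: "D \<subseteq> atoms" using assms by (auto simp: V_def)
  have c: "c \<noteq> 0" "\<And>g. g \<in> G \<Longrightarrow> c \<in> left_ideal g"
    using assms G has_len_nonzero by (auto simp: V_def)
  obtain m where m: "(\<Inter>g\<in>G. left_ideal g) = left_ideal m"
    using finite_Inter_left_ideal[of G c] c G D by blast
  have "F_independent G" using F_independent_subset[OF D assms(3)] G by blast
  then have len: "has_len (card G) m" using F_independent_has_len[of G m] G D m by blast
  have "c \<in> left_ideal m" unfolding m [symmetric] using c by blast
  then obtain r where "c = r * m" unfolding left_ideal_iff by blast
  then obtain i j where j: "has_len j m" "k = i + j" using has_len_factor assms(2) by metis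
  then have "card G = j" using has_len_unique[OF len] by blast
  then show "card G \<le> k" using j(2) by simp
qed

section \<open>F-bases and the rank\<close>

text \<open>Every Rd contains a finite intersection of ideals Rb with \<open>b\<close> in the
  basis.\<close>

lemma F_basis_Inter_left_ideal:
  fixes D :: "'a::two_fir set"
  assumes "D \<subseteq> atoms" "F_basis B D"
  shows "(\<Inter>d\<in>D. left_ideal d) = (\<Inter>b\<in>B. left_ideal b)"
proof -
  have B: "B \<subseteq> D" "B \<subseteq> atoms" "F_algebraic B" "\<And>d. d \<in> D \<Longrightarrow> F_dependent d B"
    using assms by (auto simp: F_basis_def F_independent_def)
  have "(\<Inter>b\<in>B. left_ideal b) \<subseteq> left_ideal d" if d: "d \<in> D" for d
  proof -
    obtain G where "G \<subseteq> B" "(\<Inter>g\<in>G. left_ideal g) \<subseteq> left_ideal d"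
      using B(4)[OF d] F_dependent_iff[OF B(2,3), of d] d assms(1) by blast
    then show ?thesis by blast
  qed
  then show ?thesis using B(1) by blast
qed

text \<open>Both bases have the same intersection Rm, and each cardinality is the length of
  \<open>m\<close>. Finiteness of \<open>C\<close> has to come first; it follows from
  \<open>C \<subseteq> V m\<close>.\<close>

lemma F_basis_card_unique:
  fixes D :: "'a::two_fir set"
  assumes "D \<subseteq> atoms" "F_basis B D" "F_basis C D" "finite B"
  shows "finite C \<and> card C = card B"
proof -
  have B: "B \<subseteq> atoms" "F_independent B" and C: "C \<subseteq> atoms" "F_independent C"
    using assms by (auto simp: F_basis_def)
  obtain c where c: "c \<noteq> 0" "\<And>b. b \<in> B \<Longrightarrow> c \<in> left_ideal b"
    using B F_algebraic_iff[of B] by (auto simp: F_independent_def)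
  obtain m where m: "(\<Inter>b\<in>B. left_ideal b) = left_ideal m"
    using finite_Inter_left_ideal[of B c] c B assms(4) by blast
  have len: "has_len (card B) m" using F_independent_has_len[of B m] B m assms(4) by blast
  have mC: "(\<Inter>b\<in>C. left_ideal b) = left_ideal m"
    using m F_basis_Inter_left_ideal[OF assms(1,2)] F_basis_Inter_left_ideal[OF assms(1,3)]
    by simp
  then have "m \<in> left_ideal b" if "b \<in> C" for b using that left_ideal_self[of m] by blast
  then have "C \<subseteq> V m" using C by (auto simp: V_def)
  then have "finite C" using F_independent_card_le[of C m] len C by blast
  then have "has_len (card C) m" using F_independent_has_len[of C m] C mC by blast
  then show ?thesis using \<open>finite C\<close> has_len_unique[OF len, of "card C"] by simp
qed

text \<open>Makes the definite description in \<open>rk\<close> usable. Uniqueness applied in both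
  directions shows that the bases are all finite or all infinite, and \<open>ecard\<close> does not
  distinguish infinite ones.\<close>

lemma rk_eq_ecard:
  fixes D :: "'a::two_fir set"
  assumes "D \<subseteq> atoms" "F_basis B D"
  shows "rk D = ecard B"
  unfolding rk_def
proof (rule the_equality)
  fix r
  assume "\<exists>C. F_basis C D \<and> r = ecard C"
  then obtain C where C: "F_basis C D" "r = ecard C" by blast
  have "finite B \<longleftrightarrow> finite C" "finite B \<Longrightarrow> card C = card B"
    using F_basis_card_unique[OF assms C(1)] F_basis_card_unique[OF assms(1) C(1) assms(2)]
    by blast+
  then show "r = ecard B" using C(2) by (simp add: ecard_def)
qed (use assms in blast)

text \<open>The bound \<open>k\<close> yields an independent subset of largest cardinality. An
  element not dependent on it could be adjoined: length and cardinality would both grow by one, so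
  the length criterion would give a larger independent set.\<close>

lemma F_basis_exists:
  fixes D :: "'a::two_fir set"
  assumes "D \<subseteq> V c" "has_len k c"
  obtains B where "F_basis B D" "finite B" "card B \<le> k"
proof -
  let ?P = "\<lambda>B. B \<subseteq> D \<and> F_independent B"
  have D: "D \<subseteq> atoms" using assms by (auto simp: V_def)
  have c: "c \<noteq> 0" "\<And>d. d \<in> D \<Longrightarrow> c \<in> left_ideal d"
    using assms has_len_nonzero by (auto simp: V_def)
  have bound: "finite B \<and> card B \<le> k" if "?P B" for B
    using F_independent_card_le[of B c k] that assms by blast
  have "F_independent ({}::'a set)"
    using F_algebraic_iff[of "{}::'a set"] c(1) by (auto simp: F_independent_def)
  then have empty: "?P {}" by simp
  \<comment> \<open>\<open>ex_has_greatest_nat\<close> takes a strict bound, hence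
    \<open>Suc k\<close>.\<close>
  have "\<forall>B. ?P B \<longrightarrow> card B < Suc k" using bound less_Suc_eq_le by blast
  from ex_has_greatest_nat[of ?P, OF empty this]
  obtain B where B: "?P B" and max: "\<forall>C. ?P C \<longrightarrow> card C \<le> card B" by blast
  have fin: "finite B" and le: "card B \<le> k" using bound B by blast+
  have atB: "B \<subseteq> atoms" and algB: "F_algebraic B"
    using B D by (auto simp: F_independent_def)
  obtain m where m: "(\<Inter>b\<in>B. left_ideal b) = left_ideal m"
    using finite_Inter_left_ideal[of B c] c B fin atB by blast
  have len: "has_len (card B) m" using F_independent_has_len[of B m] fin atB B m by blast
  have "F_dependent d B" if d: "d \<in> D" for d
  proof (rule ccontr)
    assume "\<not> F_dependent d B"
    then have "\<not> left_ideal m \<subseteq> left_ideal d"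
      using F_dependent_iff[OF atB algB, of d] d D fin m by blast
    then have nd: "m \<notin> left_ideal d" using left_ideal_subset_iff by blast
    then have "d \<notin> B" using left_ideal_self[of m] unfolding m [symmetric] by blast
    have "c \<in> left_ideal m" unfolding m [symmetric] using c B by blast
    then obtain m' where m': "left_ideal m \<inter> left_ideal d = left_ideal m'"
      "has_len (Suc (card B)) m'"
      using atom_Int_left_ideal[of d "card B" m c] d D len c nd by blast
    have "(\<Inter>b\<in>insert d B. left_ideal b) = left_ideal m'" using m m'(1) by auto
    moreover have sub: "insert d B \<subseteq> D" using d B by blast
    moreover have "insert d B \<subseteq> atoms" using sub D by blast
    moreover have "F_algebraic (insert d B)"
      using F_algebraic_iff[of "insert d B"] c sub D by blast
    ultimately have "F_independent (insert d B)"
      using F_independent_iff_has_len[of "insert d B" m'] fin \<open>d \<notin> B\<close> m'(2) by simp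
    then have "card (insert d B) \<le> card B" using max sub by blast
    then show False using fin \<open>d \<notin> B\<close> by simp
  qed
  then have "F_basis B D" using B by (simp add: F_basis_def)
  then show ?thesis using that fin le by blast
qed

lemma F_algebraic_V:
  fixes a :: "'a::two_fir"
  assumes "a \<noteq> 0"
  shows "F_algebraic (V a)"
  using assms F_algebraic_iff[of "V a"] by (auto simp: V_def)

lemma rk_V_le:
  fixes a :: "'a::two_fir"
  shows "rk (V a) \<le> len a"
proof (cases "len a < \<infinity>")
  case True
  then have "a \<in> finite_len" by (simp add: finite_len_def)
  then obtain n where n: "has_len n a" using finite_len_iff by blast
  obtain B where "F_basis B (V a)" "finite B" "card B \<le> n"
    using F_basis_exists[OF order_refl n] .
  then show ?thesis using rk_eq_ecard[of "V a" B] len_eq[OF n] by (auto simp: ecard_def V_def)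
qed simp

text \<open>Let \<open>n\<close> be the length of the lcm of \<open>C\<close>. A basis has the same
  lcm, so the rank is \<open>n\<close>; this is at most \<open>card C\<close>, with equality exactly
  for independent \<open>C\<close>.\<close>

lemma rk_finite:
  fixes C :: "'a::two_fir set"
  assumes "finite C" "C \<subseteq> atoms" "F_algebraic C"
  shows "rk C \<le> ecard C \<and> (rk C = ecard C \<longleftrightarrow> F_independent C)"
proof -
  obtain c where c: "c \<noteq> 0" "\<And>d. d \<in> C \<Longrightarrow> c \<in> left_ideal d"
    using F_algebraic_iff[of C] assms by blast
  obtain m n where m: "(\<Inter>d\<in>C. left_ideal d) = left_ideal m" "has_len n m" "n \<le> card C"
    using finite_Inter_left_ideal[of C c] c assms by blast
  have "m \<in> left_ideal d" if "d \<in> C" for d using that m(1) left_ideal_self[of m] by blast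
  then have "C \<subseteq> V m" using assms by (auto simp: V_def)
  then obtain B where B: "F_basis B C" "finite B" using F_basis_exists m(2) by metis
  then have "B \<subseteq> atoms" "F_independent B" using assms by (auto simp: F_basis_def)
  moreover have "(\<Inter>b\<in>B. left_ideal b) = left_ideal m"
    using F_basis_Inter_left_ideal[OF assms(2) B(1)] m(1) by simp
  ultimately have "has_len (card B) m" using F_independent_has_len[of B m] B(2) by blast
  then have "card B = n" using has_len_unique[OF _ m(2)] by blast
  then have "rk C = enat n" using rk_eq_ecard[OF assms(2) B(1)] B(2) by (simp add: ecard_def)
  moreover have "F_independent C \<longleftrightarrow> n = card C"
    using F_independent_iff_has_len[OF assms m(1)] m(2) has_len_unique[OF m(2)] by blast
  ultimately show ?thesis using m(3) assms(1) by (auto simp: ecard_def)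
qed

section \<open>Closures and part b)\<close>

lemma F_dependent_mem:
  fixes D :: "'a::two_fir set"
  assumes "D \<subseteq> atoms" "F_algebraic D" "d \<in> D"
  shows "F_dependent d D"
proof -
  have "{d} \<subseteq> D \<and> finite {d} \<and> (\<Inter>g\<in>{d}. left_ideal g) \<subseteq> left_ideal d" using assms by simp
  then show ?thesis using F_dependent_iff[of D d] assms by blast
qed

text \<open>A nonzero common left multiple of \<open>D\<close> is also one of every atom dependent
  on \<open>D\<close>.\<close>

lemma F_algebraic_F_closure:
  fixes D :: "'a::two_fir set"
  assumes "D \<subseteq> atoms" "F_algebraic D"
  shows "F_algebraic (F_closure D)"
proof -
  obtain c where c: "c \<noteq> 0" "\<And>d. d \<in> D \<Longrightarrow> c \<in> left_ideal d"
    using F_algebraic_iff[of D] assms by blast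
  have "c \<in> left_ideal p" if "p \<in> F_closure D" for p
  proof -
    have "p \<in> atoms" "F_dependent p D" using that by (auto simp: F_closure_def)
    then obtain G where "G \<subseteq> D" "(\<Inter>g\<in>G. left_ideal g) \<subseteq> left_ideal p"
      using F_dependent_iff[OF assms, of p] by blast
    then show ?thesis using c by blast
  qed
  then show ?thesis using F_algebraic_iff[of "F_closure D"] c(1) by (auto simp: F_closure_def)
qed

text \<open>Dependence is transitive: each of the finitely many \<open>g\<close> witnessing
  dependence on \<open>D\<close> depends on a finite part \<open>H g\<close> of \<open>B\<close>,
  and the union of these parts is again finite.\<close>

lemma F_closure_F_basis:
  fixes D :: "'a::two_fir set"
  assumes "D \<subseteq> atoms" "F_algebraic D" "F_basis B D"
  shows "F_closure B = F_closure D"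
proof -
  have B: "B \<subseteq> D" "B \<subseteq> atoms" "F_algebraic B" "\<And>d. d \<in> D \<Longrightarrow> F_dependent d B"
    using assms by (auto simp: F_basis_def F_independent_def)
  have "F_dependent p B \<longleftrightarrow> F_dependent p D" if p: "p \<in> atoms" for p
  proof
    assume "F_dependent p B"
    then show "F_dependent p D"
      using F_dependent_iff[OF B(2,3) p] F_dependent_iff[OF assms(1,2) p] B(1) by blast
  next
    assume "F_dependent p D"
    then obtain G where G: "G \<subseteq> D" "finite G" "(\<Inter>g\<in>G. left_ideal g) \<subseteq> left_ideal p"
      using F_dependent_iff[OF assms(1,2) p] by blast
    have "\<exists>H\<subseteq>B. finite H \<and> (\<Inter>h\<in>H. left_ideal h) \<subseteq> left_ideal g" if "g \<in> G" for g
      using F_dependent_iff[OF B(2,3), of g] B(4)[of g] that G(1) assms(1) by blast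
    then obtain H where H: "\<forall>g\<in>G. H g \<subseteq> B \<and> finite (H g) \<and> (\<Inter>h\<in>H g. left_ideal h) \<subseteq> left_ideal g"
      by metis
    have "(\<Inter>h\<in>\<Union> (H ` G). left_ideal h) \<subseteq> (\<Inter>g\<in>G. left_ideal g)" using H by fastforce
    moreover have "\<Union> (H ` G) \<subseteq> B" "finite (\<Union> (H ` G))" using H G(2) by auto
    ultimately show "F_dependent p B"
      using F_dependent_iff[OF B(2,3) p] G(3) by (meson subset_trans)
  qed
  then show ?thesis by (auto simp: F_closure_def)
qed

text \<open>One and the same \<open>B\<close> thus determines the ranks of \<open>D\<close> and of
  its closure.\<close>

lemma F_basis_F_closure:
  fixes D :: "'a::two_fir set"
  assumes "D \<subseteq> atoms" "F_algebraic D" "F_basis B D"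
  shows "F_basis B (F_closure D)"
proof -
  have "B \<subseteq> F_closure D"
    using assms F_dependent_mem[OF assms(1,2)] by (auto simp: F_basis_def F_closure_def)
  moreover have "F_dependent p B" if "p \<in> F_closure D" for p
    using that F_closure_F_basis[OF assms] by (auto simp: F_closure_def)
  ultimately show ?thesis using assms(3) by (simp add: F_basis_def)
qed

lemma rk_F_closure:
  fixes D :: "'a::two_fir set"
  assumes "D \<subseteq> atoms" "F_algebraic D" "F_basis B D"
  shows "rk D = rk (F_closure D)"
proof -
  have "F_closure D \<subseteq> atoms" by (auto simp: F_closure_def)
  then show ?thesis using rk_eq_ecard F_basis_F_closure[OF assms] assms by metis
qed

text \<open>A finite \<open>D\<close> can itself serve as the finite witness, so dependence of
  \<open>p\<close> just says that Rm lies in Rp.\<close>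

lemma F_closure_eq_V:
  fixes D :: "'a::two_fir set"
  assumes "finite D" "D \<subseteq> atoms" "F_algebraic D" "(\<Inter>d\<in>D. left_ideal d) = left_ideal m"
  shows "F_closure D = V m"
proof -
  have "F_dependent p D \<longleftrightarrow> m \<in> left_ideal p" if p: "p \<in> atoms" for p
  proof
    assume "F_dependent p D"
    then obtain G where "G \<subseteq> D" "(\<Inter>g\<in>G. left_ideal g) \<subseteq> left_ideal p"
      using F_dependent_iff[OF assms(2,3) p] by blast
    then have "left_ideal m \<subseteq> left_ideal p" unfolding assms(4) [symmetric] by blast
    then show "m \<in> left_ideal p" by (simp add: left_ideal_subset_iff)
  next
    assume "m \<in> left_ideal p"
    then have "left_ideal m \<subseteq> left_ideal p" by (simp add: left_ideal_subset_iff)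
    then show "F_dependent p D" using F_dependent_iff[OF assms(2,3) p] assms(1,4) by blast
  qed
  then show ?thesis by (auto simp: F_closure_def V_def)
qed

lemma finite_rk_principal:
  fixes D :: "'a::two_fir set"
  assumes "D \<subseteq> atoms" "F_basis B D" "rk D < \<infinity>"
  shows "finite B" "\<exists>m. (\<Inter>b\<in>B. left_ideal b) = left_ideal m"
proof -
  show fin: "finite B"
    using assms(3) rk_eq_ecard[OF assms(1,2)] by (auto simp: ecard_def split: if_splits)
  have B: "B \<subseteq> atoms" "F_algebraic B"
    using assms by (auto simp: F_basis_def F_independent_def)
  then obtain c where c: "c \<noteq> 0" "\<And>b. b \<in> B \<Longrightarrow> c \<in> left_ideal b"
    using F_algebraic_iff[of B] by blast
  then show "\<exists>m. (\<Inter>b\<in>B. left_ideal b) = left_ideal m"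
    using finite_Inter_left_ideal[of B c] B(1) fin by blast
qed

theorem lemma4p3:
  shows
    "(\<forall>a :: 'a::two_fir. a \<noteq> 0 \<longrightarrow> F_algebraic (V a) \<and> rk (V a) \<le> len a) \<and>

     (\<forall>\<Delta> B :: 'a set. \<Delta> \<subseteq> atoms \<and> F_algebraic \<Delta> \<and> F_basis B \<Delta> \<longrightarrow>
        F_algebraic (F_closure \<Delta>) \<and> F_closure B = F_closure \<Delta> \<and> rk \<Delta> = rk (F_closure \<Delta>) \<and>
        (rk \<Delta> < \<infinity> \<longrightarrow>
           (\<exists>\<Delta>\<^sub>l. (\<Inter>\<delta>\<in>\<Delta>. left_ideal \<delta>) = left_ideal \<Delta>\<^sub>l) \<and>
           (\<exists>B\<^sub>l. (\<Inter>b\<in>B. left_ideal b) = left_ideal B\<^sub>l) \<and>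
           (\<forall>\<Delta>\<^sub>l B\<^sub>l. (\<Inter>\<delta>\<in>\<Delta>. left_ideal \<delta>) = left_ideal \<Delta>\<^sub>l \<and>
                     (\<Inter>b\<in>B. left_ideal b) = left_ideal B\<^sub>l \<longrightarrow>
              F_closure \<Delta> = V \<Delta>\<^sub>l \<and> V \<Delta>\<^sub>l = V B\<^sub>l \<and> V B\<^sub>l = F_closure B))) \<and>

     (\<forall>a b m :: 'a. a \<in> finite_len \<and> b \<in> finite_len \<and>
        left_ideal a \<inter> left_ideal b \<noteq> {0} \<and> left_ideal a \<inter> left_ideal b = left_ideal m \<longrightarrow>
        (V a \<inter> V b = {} \<longleftrightarrow> left_ideal a + left_ideal b = UNIV) \<and>
        (left_ideal a + left_ideal b = UNIV \<longleftrightarrow> len m = len a + len b)) \<and>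

     (\<forall>C :: 'a set. finite C \<and> C \<subseteq> atoms \<and> F_algebraic C \<longrightarrow>
        rk C \<le> ecard C \<and> (rk C = ecard C \<longleftrightarrow> F_independent C))"
proof (intro conjI allI impI; (elim conjE)?)
  fix a :: 'a
  assume "a \<noteq> 0"
  then show "F_algebraic (V a)" by (rule F_algebraic_V)
  show "rk (V a) \<le> len a" by (rule rk_V_le)
next
  fix D B :: "'a set"
  assume D: "D \<subseteq> atoms" "F_algebraic D" "F_basis B D"
  show "F_algebraic (F_closure D)" using D(1,2) by (rule F_algebraic_F_closure)
  show closure: "F_closure B = F_closure D" using D by (rule F_closure_F_basis)
  show "rk D = rk (F_closure D)" using D by (rule rk_F_closure)
  assume rk: "rk D < \<infinity>"
  have fin: "finite B" and ex: "\<exists>m. (\<Inter>b\<in>B. left_ideal b) = left_ideal m"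
    using finite_rk_principal D(1,3) rk by blast+
  have INT: "(\<Inter>d\<in>D. left_ideal d) = (\<Inter>b\<in>B. left_ideal b)"
    using D(1,3) by (rule F_basis_Inter_left_ideal)
  show "\<exists>m. (\<Inter>d\<in>D. left_ideal d) = left_ideal m" unfolding INT by (rule ex)
  show "\<exists>m. (\<Inter>b\<in>B. left_ideal b) = left_ideal m" by (rule ex)
  have B: "B \<subseteq> atoms" "F_algebraic B" using D by (auto simp: F_basis_def F_independent_def)
  \<comment> \<open>Since \<open>D\<close> may be infinite, the description by \<open>V\<close> is
    obtained for the finite basis and carried over to \<open>D\<close> by \<open>closure\<close> and
    \<open>INT\<close>.\<close>
  have V: "F_closure B = V m" if "(\<Inter>b\<in>B. left_ideal b) = left_ideal m" for m
    using fin B that by (rule F_closure_eq_V)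
  fix d b
  assume d: "(\<Inter>d\<in>D. left_ideal d) = left_ideal d" and b: "(\<Inter>b\<in>B. left_ideal b) = left_ideal b"
  then show "F_closure D = V d" "V d = V b" "V b = F_closure B"
    using V[of d] V[of b] closure INT by simp_all
next
  fix a b m :: 'a
  assume assms: "a \<in> finite_len" "b \<in> finite_len"
    "left_ideal a \<inter> left_ideal b \<noteq> {0}" "left_ideal a \<inter> left_ideal b = left_ideal m"
  show "V a \<inter> V b = {} \<longleftrightarrow> left_ideal a + left_ideal b = UNIV"
    "left_ideal a + left_ideal b = UNIV \<longleftrightarrow> len m = len a + len b"
    by (rule V_disjoint_iff[OF assms(1,2,4,3)])+
next
  fix C :: "'a set"
  assume "finite C" "C \<subseteq> atoms" "F_algebraic C"
  then have "rk C \<le> ecard C \<and> (rk C = ecard C \<longleftrightarrow> F_independent C)" by (rule rk_finite)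
  then show "rk C \<le> ecard C" "rk C = ecard C \<longleftrightarrow> F_independent C" by blast+
qed

end
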